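(* Let $(B,+,\circ)$ be a near brace and let $z_1,z_2,\xi\in B$ be such that there exist $c_1,c_2\in B$ such that for all $a,b,c\in B$: $(a-b+c)\circ z_i=a\circ z_i-b\circ z_i+c\circ z_i$ for $i\in\{1,2\}$, $a\circ z_2\circ z_1-a\circ\xi=c_1$, and $-a\circ\xi+a\circ z_1\circ z_2=c_2$. Define $\check r:B\times B\to B\times B$ by $$\check r(a,b)=(\sigma^p_a(b),\tau^p_b(a)),\qquad \sigma^p_a(b)=a\circ b\circ z_1-a\circ\xi+z_2,\qquad \tau^p_b(a)=\sigma^p_a(b)^{-1}\circ a\circ b.$$ Then the pair $(B,\check r)$ is a solution of the braid equation.
   Context: A near brace is a set $B$ with two group operations $+$ and $\circ$ (neither necessarily abelian) such that for all $a,b,c\in B$, $a\circ(b+c)=a\circ b-a\circ 0+a\circ c$, where $0$ is the neutral element of $(B,+)$ and $1$ that of $(B,\circ)$. Here $\circ$ binds more tightly than $+,-$; $-a$ is the inverse in $(B,+)$ and $a^{-1}$ the inverse in $(B,\circ)$. $(B,\check r)$ is a solution of the braid equation if $(\check r\times\mathrm{id})(\mathrm{id}\times\check r)(\check r\times\mathrm{id})=(\mathrm{id}\times\check r)(\check r\times\mathrm{id})(\mathrm{id}\times\check r)$ on $B\times B\times B$. *)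

theory Defs
  imports "HOL-Algebra.Ring"
begin

text \<open>
  The record type of rings serves only as a signature: both operations live on one carrier, with
  \<open>\<oplus>\<close>, \<open>\<zero>\<close> for \<open>(B, +)\<close> and \<open>\<otimes>\<close>, \<open>\<one>\<close> for \<open>(B, \<circ>)\<close>. Neither group need be abelian, and
  \<open>\<zero>\<close> and \<open>\<one>\<close> may differ. Library notation: \<open>x \<ominus> y\<close> is \<open>x \<oplus> (\<ominus> y)\<close>, in this order.
  Unary \<open>\<ominus>\<close> binds more tightly than \<open>\<otimes>\<close>, hence the brackets in \<open>\<ominus> (a \<otimes> b)\<close>.
\<close>

locale near_brace = group B + add: group "add_monoid B" for B (structure) +
  assumes near_distrib:
    "\<lbrakk>a \<in> carrier B; b \<in> carrier B; c \<in> carrier B\<rbrakk>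
      \<Longrightarrow> a \<otimes> (b \<oplus> c) = a \<otimes> b \<ominus> a \<otimes> \<zero> \<oplus> a \<otimes> c"

text \<open>Triples are nested to the right; \<open>r \<times> id\<close> acts on the first two entries.\<close>

definition braid_left :: "('a \<times> 'a \<Rightarrow> 'a \<times> 'a) \<Rightarrow> 'a \<times> 'a \<times> 'a \<Rightarrow> 'a \<times> 'a \<times> 'a" where
  "braid_left r = (\<lambda>(a, b, c). (fst (r (a, b)), snd (r (a, b)), c))"

definition braid_right :: "('a \<times> 'a \<Rightarrow> 'a \<times> 'a) \<Rightarrow> 'a \<times> 'a \<times> 'a \<Rightarrow> 'a \<times> 'a \<times> 'a" where
  "braid_right r = map_prod id r"

definition braid_solution :: "'a set \<Rightarrow> ('a \<times> 'a \<Rightarrow> 'a \<times> 'a) \<Rightarrow> bool" where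
  "braid_solution X r \<longleftrightarrow>
    r \<in> X \<times> X \<rightarrow> X \<times> X \<and>
    (\<forall>p \<in> X \<times> X \<times> X.
      (braid_left r \<circ> braid_right r \<circ> braid_left r) p =
      (braid_right r \<circ> braid_left r \<circ> braid_right r) p)"

definition sigma_p :: "('a, 'b) ring_scheme \<Rightarrow> 'a \<Rightarrow> 'a \<Rightarrow> 'a \<Rightarrow> 'a \<Rightarrow> 'a \<Rightarrow> 'a" where
  "sigma_p B z\<^sub>1 z\<^sub>2 \<xi> a b =
    a \<otimes>\<^bsub>B\<^esub> b \<otimes>\<^bsub>B\<^esub> z\<^sub>1 \<ominus>\<^bsub>B\<^esub> a \<otimes>\<^bsub>B\<^esub> \<xi> \<oplus>\<^bsub>B\<^esub> z\<^sub>2"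

text \<open>In \<open>tau_p B z\<^sub>1 z\<^sub>2 \<xi> b a\<close> the subscript \<open>b\<close> comes first.\<close>

definition tau_p :: "('a, 'b) ring_scheme \<Rightarrow> 'a \<Rightarrow> 'a \<Rightarrow> 'a \<Rightarrow> 'a \<Rightarrow> 'a \<Rightarrow> 'a" where
  "tau_p B z\<^sub>1 z\<^sub>2 \<xi> b a = inv\<^bsub>B\<^esub> (sigma_p B z\<^sub>1 z\<^sub>2 \<xi> a b) \<otimes>\<^bsub>B\<^esub> a \<otimes>\<^bsub>B\<^esub> b"

definition r_p :: "('a, 'b) ring_scheme \<Rightarrow> 'a \<Rightarrow> 'a \<Rightarrow> 'a \<Rightarrow> 'a \<times> 'a \<Rightarrow> 'a \<times> 'a" where
  "r_p B z\<^sub>1 z\<^sub>2 \<xi> = (\<lambda>(a, b). (sigma_p B z\<^sub>1 z\<^sub>2 \<xi> a b, tau_p B z\<^sub>1 z\<^sub>2 \<xi> b a))"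

end

theory Submission
  imports Defs
begin

text \<open>
  Left multiplications of a near brace, and right multiplication by \<open>z\<^sub>1\<close> and \<open>z\<^sub>2\<close>, preserve the
  ternary operation \<open>x - y + w\<close>. Since \<open>\<sigma>\<^sub>a(b) \<circ> \<tau>\<^sub>b(a) = a \<circ> b\<close>, both sides of the braid equation
  have the same product \<open>a \<circ> b \<circ> c\<close>, so it suffices to compare their first entries and the
  products of their first two entries. Expanding these gives
  \<open>\<sigma>\<^sub>a(\<sigma>\<^sub>b(c)) = a\<circ>b\<circ>c\<circ>z\<^sub>1\<circ>z\<^sub>1 - a\<circ>b\<circ>\<xi>\<circ>z\<^sub>1 + c\<^sub>1 + z\<^sub>2\<close> and
  \<open>\<sigma>\<^sub>a(b) \<circ> \<sigma>\<^bsub>\<tau>\<^sub>b(a)\<^esub>(c) = a\<circ>b\<circ>c\<circ>z\<^sub>1 + c\<^sub>2 - a\<circ>\<xi>\<circ>z\<^sub>2 + z\<^sub>2\<circ>z\<^sub>2\<close>. The first depends on \<open>a\<close>, \<open>b\<close> only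
  through \<open>a \<circ> b\<close>, the second on \<open>b\<close>, \<open>c\<close> only through \<open>b \<circ> c\<close>; hence neither changes under
  the braiding of these pairs.
\<close>

context near_brace
begin

lemma add_closed [simp, intro]: "x \<in> carrier B \<Longrightarrow> y \<in> carrier B \<Longrightarrow> x \<oplus> y \<in> carrier B"
  using add.m_closed by simp

lemma neg_closed [simp, intro]: "x \<in> carrier B \<Longrightarrow> \<ominus> x \<in> carrier B"
  using add.inv_closed by (simp add: a_inv_def)

lemma zero_closed [simp, intro]: "\<zero> \<in> carrier B"
  using add.one_closed by simp

lemma minus_closed [simp, intro]: "x \<in> carrier B \<Longrightarrow> y \<in> carrier B \<Longrightarrow> x \<ominus> y \<in> carrier B"
  by (simp add: a_minus_def)

lemma add_assoc:
  "x \<in> carrier B \<Longrightarrow> y \<in> carrier B \<Longrightarrow> z \<in> carrier B \<Longrightarrow> x \<oplus> y \<oplus> z = x \<oplus> (y \<oplus> z)"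
  using add.m_assoc by simp

lemma zero_add [simp]: "x \<in> carrier B \<Longrightarrow> \<zero> \<oplus> x = x"
  using add.l_one by simp

lemma add_neg [simp]: "x \<in> carrier B \<Longrightarrow> x \<oplus> \<ominus> x = \<zero>"
  using add.r_inv by (simp add: a_inv_def)

lemma neg_add [simp]: "x \<in> carrier B \<Longrightarrow> \<ominus> x \<oplus> x = \<zero>"
  using add.l_inv by (simp add: a_inv_def)

lemma neg_add_cancel: "x \<in> carrier B \<Longrightarrow> y \<in> carrier B \<Longrightarrow> \<ominus> x \<oplus> (x \<oplus> y) = y"
  by (metis add_assoc neg_add neg_closed zero_add)

text \<open>Splitting \<open>w\<close> as \<open>y \<oplus> (\<ominus> y \<oplus> w)\<close> and
  applying \<open>near_distrib\<close> expresses \<open>a \<otimes> (\<ominus> y \<oplus> w)\<close>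
  through \<open>a \<otimes> y\<close>, \<open>a \<otimes> w\<close> and
  \<open>a \<otimes> \<zero>\<close>. A second application, with \<open>x\<close> in front, cancels
  the \<open>a \<otimes> \<zero>\<close> terms.\<close>

lemma mult_heap:
  assumes [simp]: "a \<in> carrier B" "x \<in> carrier B" "y \<in> carrier B" "w \<in> carrier B"
  shows "a \<otimes> (x \<ominus> y \<oplus> w) = a \<otimes> x \<ominus> a \<otimes> y \<oplus> a \<otimes> w"
proof -
  have "a \<otimes> (y \<oplus> (\<ominus> y \<oplus> w)) = a \<otimes> y \<ominus> a \<otimes> \<zero> \<oplus> a \<otimes> (\<ominus> y \<oplus> w)"
    by (rule near_distrib) auto
  then have "a \<otimes> w = a \<otimes> y \<oplus> (\<ominus> (a \<otimes> \<zero>) \<oplus> a \<otimes> (\<ominus> y \<oplus> w))"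
    by (simp add: add_assoc a_minus_def flip: add_assoc[of y])
  then have w: "\<ominus> (a \<otimes> y) \<oplus> a \<otimes> w = \<ominus> (a \<otimes> \<zero>) \<oplus> a \<otimes> (\<ominus> y \<oplus> w)"
    by (simp add: neg_add_cancel)
  have "a \<otimes> (x \<oplus> (\<ominus> y \<oplus> w)) = a \<otimes> x \<ominus> a \<otimes> \<zero> \<oplus> a \<otimes> (\<ominus> y \<oplus> w)"
    by (rule near_distrib) auto
  then show ?thesis
    by (simp add: a_minus_def add_assoc w)
qed

end

text \<open>Fixing the witnesses \<open>c\<^sub>1\<close> and \<open>c\<^sub>2\<close> lets the
  closed forms below mention them.\<close>

locale near_brace_parameters = near_brace +
  fixes z\<^sub>1 z\<^sub>2 \<xi> c\<^sub>1 c\<^sub>2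
  assumes params_closed [simp]:
      "z\<^sub>1 \<in> carrier B" "z\<^sub>2 \<in> carrier B" "\<xi> \<in> carrier B" "c\<^sub>1 \<in> carrier B" "c\<^sub>2 \<in> carrier B"
    and heap_mult: "\<lbrakk>z \<in> {z\<^sub>1, z\<^sub>2}; a \<in> carrier B; b \<in> carrier B; c \<in> carrier B\<rbrakk>
      \<Longrightarrow> (a \<ominus> b \<oplus> c) \<otimes> z = a \<otimes> z \<ominus> b \<otimes> z \<oplus> c \<otimes> z"
    and c1: "a \<in> carrier B \<Longrightarrow> a \<otimes> z\<^sub>2 \<otimes> z\<^sub>1 \<ominus> a \<otimes> \<xi> = c\<^sub>1"
    and c2: "a \<in> carrier B \<Longrightarrow> \<ominus> (a \<otimes> \<xi>) \<oplus> a \<otimes> z\<^sub>1 \<otimes> z\<^sub>2 = c\<^sub>2"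
begin

abbreviation \<sigma> where "\<sigma> \<equiv> sigma_p B z\<^sub>1 z\<^sub>2 \<xi>"

abbreviation \<tau> where "\<tau> \<equiv> tau_p B z\<^sub>1 z\<^sub>2 \<xi>"

lemma sigma_closed [simp]: "a \<in> carrier B \<Longrightarrow> b \<in> carrier B \<Longrightarrow> \<sigma> a b \<in> carrier B"
  by (simp add: sigma_p_def)

lemma tau_closed [simp]: "a \<in> carrier B \<Longrightarrow> b \<in> carrier B \<Longrightarrow> \<tau> b a \<in> carrier B"
  by (simp add: tau_p_def)

lemma sigma_mult_tau:
  "a \<in> carrier B \<Longrightarrow> b \<in> carrier B \<Longrightarrow> \<sigma> a b \<otimes> \<tau> b a = a \<otimes> b"
  by (simp add: tau_p_def flip: m_assoc)

text \<open>\<open>mult_heap\<close> moves \<open>a\<close> into \<open>\<sigma> b c\<close>, then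
  \<open>heap_mult\<close> distributes \<open>z\<^sub>1\<close>. The two terms with \<open>a\<close>
  but without \<open>b\<close> are adjacent and form \<open>c\<^sub>1\<close>.\<close>

lemma sigma_sigma:
  assumes [simp]: "a \<in> carrier B" "b \<in> carrier B" "c \<in> carrier B"
  shows "\<sigma> a (\<sigma> b c) = a \<otimes> b \<otimes> c \<otimes> z\<^sub>1 \<otimes> z\<^sub>1 \<ominus> a \<otimes> b \<otimes> \<xi> \<otimes> z\<^sub>1 \<oplus> c\<^sub>1 \<oplus> z\<^sub>2"
proof -
  have "\<sigma> a (\<sigma> b c) =
      (a \<otimes> (b \<otimes> c \<otimes> z\<^sub>1) \<ominus> a \<otimes> (b \<otimes> \<xi>) \<oplus> a \<otimes> z\<^sub>2) \<otimes> z\<^sub>1 \<ominus> a \<otimes> \<xi> \<oplus> z\<^sub>2"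
    by (simp add: sigma_p_def mult_heap)
  also have "\<dots> = a \<otimes> b \<otimes> c \<otimes> z\<^sub>1 \<otimes> z\<^sub>1 \<ominus> a \<otimes> b \<otimes> \<xi> \<otimes> z\<^sub>1
      \<oplus> (a \<otimes> z\<^sub>2 \<otimes> z\<^sub>1 \<ominus> a \<otimes> \<xi>) \<oplus> z\<^sub>2"
    by (subst heap_mult) (simp_all add: m_assoc add_assoc a_minus_def)
  finally show ?thesis
    by (simp add: c1)
qed

text \<open>Left multiplication by \<open>\<sigma> a b\<close> turns each \<open>\<tau> b a\<close>
  into \<open>a \<otimes> b\<close>. The two terms with \<open>b\<close> but without
  \<open>c\<close> then form \<open>c\<^sub>2\<close>, by \<open>c2\<close> at
  \<open>a \<otimes> b\<close>.\<close>

lemma sigma_mult_sigma_tau: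
  assumes [simp]: "a \<in> carrier B" "b \<in> carrier B" "c \<in> carrier B"
  shows "\<sigma> a b \<otimes> \<sigma> (\<tau> b a) c = a \<otimes> (b \<otimes> c) \<otimes> z\<^sub>1 \<oplus> c\<^sub>2 \<ominus> a \<otimes> \<xi> \<otimes> z\<^sub>2 \<oplus> z\<^sub>2 \<otimes> z\<^sub>2"
proof -
  \<comment> \<open>Only the second factor is unfolded: \<open>\<sigma> a b\<close> must stay intact
    to meet \<open>\<tau> b a\<close> in \<open>sigma_mult_tau\<close>.\<close>
  have "\<sigma> a b \<otimes> \<sigma> (\<tau> b a) c =
      \<sigma> a b \<otimes> (\<tau> b a \<otimes> c \<otimes> z\<^sub>1) \<ominus> \<sigma> a b \<otimes> (\<tau> b a \<otimes> \<xi>) \<oplus> \<sigma> a b \<otimes> z\<^sub>2"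
    by (simp add: sigma_p_def[of _ _ _ _ "\<tau> b a"] mult_heap)
  also have "\<dots> = a \<otimes> b \<otimes> c \<otimes> z\<^sub>1 \<ominus> a \<otimes> b \<otimes> \<xi> \<oplus> \<sigma> a b \<otimes> z\<^sub>2"
    by (simp add: sigma_mult_tau flip: m_assoc)
  also have "\<sigma> a b \<otimes> z\<^sub>2 = a \<otimes> b \<otimes> z\<^sub>1 \<otimes> z\<^sub>2 \<ominus> a \<otimes> \<xi> \<otimes> z\<^sub>2 \<oplus> z\<^sub>2 \<otimes> z\<^sub>2"
    by (simp add: sigma_p_def heap_mult)
  also have "a \<otimes> b \<otimes> c \<otimes> z\<^sub>1 \<ominus> a \<otimes> b \<otimes> \<xi> \<oplus> \<dots> =
      a \<otimes> (b \<otimes> c) \<otimes> z\<^sub>1 \<oplus> (\<ominus> (a \<otimes> b \<otimes> \<xi>) \<oplus> a \<otimes> b \<otimes> z\<^sub>1 \<otimes> z\<^sub>2) \<ominus> a \<otimes> \<xi> \<otimes> z\<^sub>2 \<oplus> z\<^sub>2 \<otimes> z\<^sub>2"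
    by (simp add: m_assoc add_assoc a_minus_def)
  finally show ?thesis
    by (simp add: c2)
qed

lemma braid_solution_r_p: "braid_solution (carrier B) (r_p B z\<^sub>1 z\<^sub>2 \<xi>)"
proof -
  have "(braid_left (r_p B z\<^sub>1 z\<^sub>2 \<xi>) \<circ> braid_right (r_p B z\<^sub>1 z\<^sub>2 \<xi>) \<circ> braid_left (r_p B z\<^sub>1 z\<^sub>2 \<xi>)) (a, b, c) =
      (braid_right (r_p B z\<^sub>1 z\<^sub>2 \<xi>) \<circ> braid_left (r_p B z\<^sub>1 z\<^sub>2 \<xi>) \<circ> braid_right (r_p B z\<^sub>1 z\<^sub>2 \<xi>)) (a, b, c)"
    if [simp]: "a \<in> carrier B" "b \<in> carrier B" "c \<in> carrier B" for a b c
  proof -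
    let ?s = "\<sigma> b c" and ?t = "\<tau> c b"
    let ?u = "\<sigma> a b" and ?v = "\<tau> b a"
    let ?x = "\<sigma> ?u (\<sigma> ?v c)" and ?y = "\<tau> (\<sigma> ?v c) ?u" and ?z = "\<tau> c ?v"
    let ?x' = "\<sigma> a ?s" and ?y' = "\<sigma> (\<tau> ?s a) ?t" and ?z' = "\<tau> ?t (\<tau> ?s a)"
    have x: "?x = ?x'"
      by (simp add: sigma_sigma sigma_mult_tau)
    \<comment> \<open>The left side equals \<open>?u \<otimes> \<sigma> ?v c\<close>, so both sides
      have the form treated in \<open>sigma_mult_sigma_tau\<close>, and
      \<open>?s \<otimes> ?t = b \<otimes> c\<close>.\<close>
    have xy: "?x \<otimes> ?y = ?x' \<otimes> ?y'"
      by (simp add: sigma_mult_tau sigma_mult_sigma_tau)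
    then have y: "?y = ?y'"
      unfolding x by simp
    \<comment> \<open>For the third entries, both triple products are reduced to
      \<open>a \<otimes> b \<otimes> c\<close>; \<open>xy\<close> then allows left
      cancellation.\<close>
    have "?x \<otimes> ?y \<otimes> ?z = ?u \<otimes> (\<sigma> ?v c \<otimes> ?z)"
      by (simp add: sigma_mult_tau m_assoc)
    also have "\<dots> = a \<otimes> b \<otimes> c"
      by (simp add: sigma_mult_tau flip: m_assoc)
    also have "\<dots> = a \<otimes> (?s \<otimes> ?t)"
      by (simp add: sigma_mult_tau m_assoc)
    \<comment> \<open>The instance at \<open>a\<close> keeps \<open>?s \<otimes> ?t\<close> from
      collapsing back to \<open>b \<otimes> c\<close>.\<close>
    also have "\<dots> = ?x' \<otimes> \<tau> ?s a \<otimes> ?t"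
      by (simp add: sigma_mult_tau[of a] flip: m_assoc)
    also have "\<dots> = ?x' \<otimes> ?y' \<otimes> ?z'"
      by (simp add: sigma_mult_tau[of "\<tau> ?s a"] m_assoc)
    finally have "?z = ?z'"
      unfolding xy by simp
    with x y show ?thesis
      by (simp add: braid_left_def braid_right_def r_p_def)
  qed
  then show ?thesis
    unfolding braid_solution_def by (auto simp: r_p_def)
qed

end

theorem theorem2p19:
  fixes B :: "('a, 'b) ring_scheme" (structure)
    and z\<^sub>1 z\<^sub>2 \<xi> :: 'a
  assumes "near_brace B"
    and "z\<^sub>1 \<in> carrier B" and "z\<^sub>2 \<in> carrier B" and "\<xi> \<in> carrier B"
    and "\<exists>c\<^sub>1 \<in> carrier B. \<exists>c\<^sub>2 \<in> carrier B.
      \<forall>a \<in> carrier B. \<forall>b \<in> carrier B. \<forall>c \<in> carrier B.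
        (\<forall>z \<in> {z\<^sub>1, z\<^sub>2}. (a \<ominus> b \<oplus> c) \<otimes> z = a \<otimes> z \<ominus> b \<otimes> z \<oplus> c \<otimes> z) \<and>
        a \<otimes> z\<^sub>2 \<otimes> z\<^sub>1 \<ominus> a \<otimes> \<xi> = c\<^sub>1 \<and>
        \<ominus> (a \<otimes> \<xi>) \<oplus> a \<otimes> z\<^sub>1 \<otimes> z\<^sub>2 = c\<^sub>2"
  shows "braid_solution (carrier B) (r_p B z\<^sub>1 z\<^sub>2 \<xi>)"
proof -
  obtain c\<^sub>1 c\<^sub>2 where c: "c\<^sub>1 \<in> carrier B" "c\<^sub>2 \<in> carrier B"
    "\<forall>a \<in> carrier B. \<forall>b \<in> carrier B. \<forall>c \<in> carrier B.
        (\<forall>z \<in> {z\<^sub>1, z\<^sub>2}. (a \<ominus> b \<oplus> c) \<otimes> z = a \<otimes> z \<ominus> b \<otimes> z \<oplus> c \<otimes> z) \<and>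
        a \<otimes> z\<^sub>2 \<otimes> z\<^sub>1 \<ominus> a \<otimes> \<xi> = c\<^sub>1 \<and>
        \<ominus> (a \<otimes> \<xi>) \<oplus> a \<otimes> z\<^sub>1 \<otimes> z\<^sub>2 = c\<^sub>2"
    using assms(5) by blast
  interpret near_brace B by fact
  interpret near_brace_parameters B z\<^sub>1 z\<^sub>2 \<xi> c\<^sub>1 c\<^sub>2
    using assms(2-4) c by unfold_locales blast+
  show ?thesis
    by (rule braid_solution_r_p)
qed

end
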